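(* For every $n\ge 2$, the complete graph $K_n$ satisfies $\mathrm{Ric}(K_n)=1+\frac n2$.
   Context: For a graph $G=(V,E)$ (undirected, simple, locally finite, no isolated vertices; $y\sim x$ means adjacency) and $f,g:V\to\mathbb R$ define $\Delta f(x)=\sum_{y\sim x}(f(y)-f(x))$, $\Gamma(f,g)(x)=\frac12\sum_{y\sim x}(f(x)-f(y))(g(x)-g(y))$, $\Gamma(f)=\Gamma(f,f)$, $\Gamma_2(f)=\frac12\Delta\Gamma(f)-\Gamma(f,\Delta f)$. The curvature $\mathrm{Ric}(G)$ is the largest $K\in\mathbb R$ such that $\Gamma_2(f)(x)\ge K\,\Gamma(f)(x)$ for all $f:V\to\mathbb R$ and all $x\in V$. *)

theory Defs
  imports Complex_Main "Graph_Theory.Graph_Theory"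
begin

text \<open>
  Undirected simple graphs are symmetric digraphs without loops and parallel arcs. The locale
  \<open>graph\<close> of the library additionally demands finiteness, which is relaxed here to local
  finiteness.
\<close>

locale lf_graph = loopfree_digraph + nomulti_digraph + sym_digraph +
  assumes locally_finite: "x \<in> verts G \<Longrightarrow> finite {y. x \<rightarrow>\<^bsub>G\<^esub> y}"
    and no_isolated: "x \<in> verts G \<Longrightarrow> \<exists>y. x \<rightarrow>\<^bsub>G\<^esub> y"

text \<open>
  Functions on the vertex set are total functions on the vertex type. In a well-formed graph the
  neighbours of a vertex are vertices, so at vertices the operators below depend only on the
  values of their arguments on \<open>verts G\<close>.
\<close>

definition laplacian :: "('a,'b) pre_digraph \<Rightarrow> ('a \<Rightarrow> real) \<Rightarrow> 'a \<Rightarrow> real" where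
  "laplacian G f x = (\<Sum>y | x \<rightarrow>\<^bsub>G\<^esub> y. f y - f x)"

definition Gamma1 :: "('a,'b) pre_digraph \<Rightarrow> ('a \<Rightarrow> real) \<Rightarrow> ('a \<Rightarrow> real) \<Rightarrow> 'a \<Rightarrow> real" where
  "Gamma1 G f g x = 1/2 * (\<Sum>y | x \<rightarrow>\<^bsub>G\<^esub> y. (f x - f y) * (g x - g y))"

definition Gamma2 :: "('a,'b) pre_digraph \<Rightarrow> ('a \<Rightarrow> real) \<Rightarrow> 'a \<Rightarrow> real" where
  "Gamma2 G f x = 1/2 * laplacian G (Gamma1 G f f) x - Gamma1 G f (laplacian G f) x"

definition Ric :: "('a,'b) pre_digraph \<Rightarrow> real" where
  "Ric G = (GREATEST K. \<forall>f. \<forall>x \<in> verts G. Gamma2 G f x \<ge> K * Gamma1 G f f x)"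

lemma lf_graph_complete_digraph:
  assumes "n \<ge> 2" and "complete_digraph n G"
  shows "lf_graph G"
proof -
  interpret graph G using assms(2) by (simp add: complete_digraph_def)
  have ends: "arcs_ends G = {(u,v). (u,v) \<in> verts G \<times> verts G \<and> u \<noteq> v}"
    and card: "card (verts G) = n"
    using assms(2) by (simp_all add: complete_digraph_def)
  show ?thesis
  proof unfold_locales
    fix x assume x: "x \<in> verts G"
    show "finite {y. x \<rightarrow>\<^bsub>G\<^esub> y}"
      by (rule finite_subset[OF _ finite_verts]) (auto simp: ends)
    have "verts G \<noteq> {x}" using card assms(1) by auto
    then show "\<exists>y. x \<rightarrow>\<^bsub>G\<^esub> y" using x by (auto simp: ends)
  qed
qed

end

theory Submission
  imports Defs "HOL-Analysis.Convex"
begin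

text \<open>
  On \<open>K\<^sub>n\<close> the operators are polynomial in the moments \<open>\<Sum>f\<close> and \<open>\<Sum>f\<^sup>2\<close>, which gives the identity
  \<open>\<Gamma>\<^sub>2(f) = 3n/2 \<Gamma>(f) - (\<Delta>f)\<^sup>2/2\<close>. Since \<open>\<Delta>f(x)\<close> is a sum of \<open>n - 1\<close> differences, Cauchy--Schwarz gives
  \<open>(\<Delta>f)\<^sup>2 \<le> 2(n - 1) \<Gamma>(f)\<close>, hence \<open>\<Gamma>\<^sub>2(f) \<ge> (1 + n/2) \<Gamma>(f)\<close>. Equality holds at \<open>x\<close> when \<open>f\<close> is the
  indicator function of \<open>x\<close>.
\<close>

context
  fixes n :: nat and G :: "('a, 'b) pre_digraph"
  assumes complete: "complete_digraph n G"
begin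

lemma card_verts_complete_digraph: "card (verts G) = n"
  using complete by (simp add: complete_digraph_def)

lemma finite_verts_complete_digraph: "finite (verts G)"
proof -
  interpret graph G using complete by (simp add: complete_digraph_def)
  show ?thesis by simp
qed

lemma neighbours_complete_digraph:
  assumes "x \<in> verts G"
  shows "{y. x \<rightarrow>\<^bsub>G\<^esub> y} = verts G - {x}"
  using complete assms by (auto simp: complete_digraph_def)

lemma laplacian_complete_digraph:
  assumes "x \<in> verts G"
  shows "laplacian G f x = (\<Sum>y\<in>verts G. f y) - real n * f x"
proof -
  \<comment> \<open>The term at \<open>y = x\<close> vanishes, so the index set can be made
    independent of \<open>x\<close>.\<close>
  have "laplacian G f x = (\<Sum>y\<in>verts G. f y - f x)"
    unfolding laplacian_def neighbours_complete_digraph[OF assms]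
    by (simp add: sum.remove[OF finite_verts_complete_digraph assms])
  then show ?thesis
    by (simp add: sum_subtractf card_verts_complete_digraph)
qed

lemma Gamma1_complete_digraph:
  assumes "x \<in> verts G"
  shows "Gamma1 G f g x = 1/2 * (\<Sum>y\<in>verts G. (f x - f y) * (g x - g y))"
  unfolding Gamma1_def neighbours_complete_digraph[OF assms]
  by (simp add: sum.remove[OF finite_verts_complete_digraph assms])

text \<open>Both moments are independent of \<open>x\<close>, so this form can be summed over
  \<open>x\<close> again, as the Laplacian of \<open>Gamma1 G f f\<close> requires.\<close>

lemma Gamma1_moments_complete_digraph:
  assumes "x \<in> verts G"
  shows "Gamma1 G f f x =
    1/2 * (real n * (f x)\<^sup>2 - 2 * f x * (\<Sum>y\<in>verts G. f y) + (\<Sum>y\<in>verts G. (f y)\<^sup>2))"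
proof -
  have "(\<Sum>y\<in>verts G. (f x - f y) * (f x - f y)) =
    (\<Sum>y\<in>verts G. (f x)\<^sup>2 - 2 * f x * f y + (f y)\<^sup>2)"
    by (rule sum.cong) (auto simp: power2_eq_square algebra_simps)
  also have "\<dots> = real n * (f x)\<^sup>2 - 2 * f x * (\<Sum>y\<in>verts G. f y) + (\<Sum>y\<in>verts G. (f y)\<^sup>2)"
    by (simp add: sum.distrib sum_subtractf sum_distrib_left card_verts_complete_digraph)
  finally show ?thesis
    by (simp add: Gamma1_complete_digraph[OF assms])
qed

text \<open>Up to an additive constant the Laplacian is multiplication by \<open>-n\<close>, and
  constants cancel in the differences inside \<open>Gamma1\<close>.\<close>

lemma Gamma1_laplacian_complete_digraph:
  assumes "x \<in> verts G"
  shows "Gamma1 G f (laplacian G f) x = - real n * Gamma1 G f f x"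
proof -
  have "(\<Sum>y\<in>verts G. (f x - f y) * (laplacian G f x - laplacian G f y)) =
    (\<Sum>y\<in>verts G. - real n * ((f x - f y) * (f x - f y)))"
    by (rule sum.cong) (auto simp: laplacian_complete_digraph assms algebra_simps)
  then show ?thesis
    by (simp add: Gamma1_complete_digraph[OF assms] sum_distrib_left sum_negf)
qed

lemma Gamma2_complete_digraph:
  assumes "x \<in> verts G"
  shows "Gamma2 G f x = 3 * real n / 2 * Gamma1 G f f x - (laplacian G f x)\<^sup>2 / 2"
proof -
  define S where "S = (\<Sum>y\<in>verts G. f y)"
  define Q where "Q = (\<Sum>y\<in>verts G. (f y)\<^sup>2)"
  have Gx: "Gamma1 G f f x = 1/2 * (real n * (f x)\<^sup>2 - 2 * f x * S + Q)"
    by (simp add: Gamma1_moments_complete_digraph[OF assms] S_def Q_def)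
  have "(\<Sum>y\<in>verts G. Gamma1 G f f y) =
    (\<Sum>y\<in>verts G. real n / 2 * (f y)\<^sup>2 - S * f y + Q / 2)"
    by (rule sum.cong) (auto simp: Gamma1_moments_complete_digraph S_def Q_def algebra_simps)
  also have "\<dots> = real n / 2 * Q - S * S + real n * (Q / 2)"
    by (simp add: sum.distrib sum_subtractf card_verts_complete_digraph S_def Q_def
        sum_distrib_left sum_divide_distrib)
  finally have sum_G: "(\<Sum>y\<in>verts G. Gamma1 G f f y) = real n * Q - S\<^sup>2"
    by (simp add: power2_eq_square)
  \<comment> \<open>The algebra rests on \<open>n * Q - S\<^sup>2 = 2 * n * Gamma1 G f f x - (S - n
    * f x)\<^sup>2\<close>, where \<open>S - n * f x\<close> is the Laplacian at
    \<open>x\<close>.\<close>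
  show ?thesis
    unfolding Gamma2_def Gamma1_laplacian_complete_digraph[OF assms]
      laplacian_complete_digraph[OF assms] sum_G S_def[symmetric] Gx
    by (simp add: power2_eq_square field_simps)
qed

lemma laplacian_square_le_complete_digraph:
  assumes "x \<in> verts G"
  shows "(laplacian G f x)\<^sup>2 \<le> 2 * (real n - 1) * Gamma1 G f f x"
proof -
  have "n > 0"
    using assms finite_verts_complete_digraph card_verts_complete_digraph card_gt_0_iff by blast
  then have card: "real (card (verts G - {x})) = real n - 1"
    using assms by (simp add: card_verts_complete_digraph of_nat_diff)
  \<comment> \<open>Summing over the \<open>n - 1\<close> neighbours matters: keeping the zero term
    at \<open>x\<close> would give the factor \<open>n\<close> and only the curvature bound
    \<open>n / 2\<close>.\<close>
  have "(laplacian G f x)\<^sup>2 \<le> (\<Sum>y\<in>verts G - {x}. (f y - f x)\<^sup>2) * card (verts G - {x})"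
    unfolding laplacian_def neighbours_complete_digraph[OF assms]
    by (rule sum_squared_le_sum_of_squares)
  also have "(\<Sum>y\<in>verts G - {x}. (f y - f x)\<^sup>2) = 2 * Gamma1 G f f x"
    unfolding Gamma1_def neighbours_complete_digraph[OF assms]
    by (simp add: power2_eq_square algebra_simps)
  finally show ?thesis
    by (simp add: card algebra_simps)
qed

text \<open>The constant arises as \<open>3 * n / 2 - (n - 1)\<close>.\<close>

lemma Gamma2_ge_complete_digraph:
  assumes "x \<in> verts G"
  shows "(1 + real n / 2) * Gamma1 G f f x \<le> Gamma2 G f x"
  using laplacian_square_le_complete_digraph[OF assms, of f]
  by (simp add: Gamma2_complete_digraph[OF assms] field_simps)

lemma curvature_bound_le_complete_digraph:
  assumes "n \<ge> 2" and x: "x \<in> verts G"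
    and K: "\<And>f. K * Gamma1 G f f x \<le> Gamma2 G f x"
  shows "K \<le> 1 + real n / 2"
proof -
  \<comment> \<open>All differences \<open>f y - f x\<close> over neighbours equal
    \<open>-1\<close>, the equality case of Cauchy--Schwarz.\<close>
  define f :: "'a \<Rightarrow> real" where "f y = of_bool (y = x)" for y
  have sums: "(\<Sum>y\<in>verts G. f y) = 1" "(\<Sum>y\<in>verts G. (f y)\<^sup>2) = 1" and "f x = 1"
    using x by (simp_all add: f_def finite_verts_complete_digraph of_bool_def if_distrib
        sum.remove[OF finite_verts_complete_digraph x])
  have G1: "Gamma1 G f f x = (real n - 1) / 2"
    by (simp add: Gamma1_moments_complete_digraph[OF x] sums \<open>f x = 1\<close>)
  have "Gamma2 G f x = (1 + real n / 2) * Gamma1 G f f x"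
    by (simp add: Gamma2_complete_digraph[OF x] laplacian_complete_digraph[OF x] sums \<open>f x = 1\<close> G1
        power2_eq_square field_simps)
  with K[of f] have "K * Gamma1 G f f x \<le> (1 + real n / 2) * Gamma1 G f f x"
    by simp
  \<comment> \<open>Strict positivity allows cancelling the factor; for \<open>n = 1\<close> it
    would be zero.\<close>
  moreover have "Gamma1 G f f x > 0"
    using G1 \<open>n \<ge> 2\<close> by simp
  ultimately show ?thesis
    by simp
qed

end

theorem theorem4:
  fixes n :: nat and G :: "('a, 'b) pre_digraph"
  assumes "n \<ge> 2" and "complete_digraph n G"
  shows "Ric G = 1 + real n / 2"
  unfolding Ric_def
proof (rule Greatest_equality)
  show "\<forall>f. \<forall>x\<in>verts G. (1 + real n / 2) * Gamma1 G f f x \<le> Gamma2 G f x"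
    using Gamma2_ge_complete_digraph[OF assms(2)] by blast
next
  fix K assume K: "\<forall>f. \<forall>x\<in>verts G. K * Gamma1 G f f x \<le> Gamma2 G f x"
  \<comment> \<open>Without a vertex the condition on \<open>K\<close> would be vacuous.\<close>
  obtain x where "x \<in> verts G"
    using card_verts_complete_digraph[OF assms(2)] assms(1) by fastforce
  then show "K \<le> 1 + real n / 2"
    using curvature_bound_le_complete_digraph[OF assms(2,1)] K by blast
qed

end
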